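(* Let $b\ge2$ and $N\ge1$ be integers. The batched rejection sampler $\mathcal{S}_N(b)$, run on a source $\mathcal{R}$ of independent uniform random bits, terminates with probability $1$ and outputs a tuple $(k_1,\dots,k_N)$ that is uniform on $\{0,\dots,b-1\}^N$ with mutually independent digits.
   Context: Batched rejection sampler $\mathcal{S}_N(b)$: let $Q=b^N$ and $q=\lceil\log_2 Q\rceil$. (1) Draw $q$ fresh bits from $\mathcal{R}$ and interpret them as an integer $U\in\{0,\dots,2^q-1\}$. (2) If $U\ge Q$, discard $U$ and return to step 1. (3) Apply the inverse Horner decomposition with base sequence $(b,\dots,b)$ of length $N$ to $U$: for $i=N,N-1,\dots,1$, set $k_i=U\bmod b$ and then $U\leftarrow\lfloor U/b\rfloor$. (4) Return $(k_1,\dots,k_N)$. *)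

theory Defs
  imports "HOL-Probability.Probability" "HOL-Library.While_Combinator"
begin

definition random_bit_source :: "'a measure \<Rightarrow> (nat \<Rightarrow> 'a \<Rightarrow> bool) \<Rightarrow> bool" where
  "random_bit_source M R \<longleftrightarrow>
     prob_space M \<and>
     prob_space.indep_vars M (\<lambda>_. count_space UNIV) R UNIV \<and>
     (\<forall>n. distr M (count_space UNIV) (R n) = measure_pmf (pmf_of_set UNIV))"

(* The second argument is the position of the first unread bit of r; the result pairs the
   integer read, most significant bit first, with the new position.  The list is reversed
   because horner_sum is least significant digit first. *)
definition draw_bits :: "(nat \<Rightarrow> bool) \<Rightarrow> nat \<Rightarrow> nat \<Rightarrow> nat \<times> nat" where
  "draw_bits r p q = (horner_sum of_bool 2 (rev (map r [p..<p + q])), p + q)"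

(* foldr visits the bases from last to first, so the digit for the last base is extracted
   first; the digits are nevertheless listed in the order of the bases. *)
definition inverse_horner :: "nat list \<Rightarrow> nat \<Rightarrow> nat list" where
  "inverse_horner bs U = snd (foldr (\<lambda>b (U, ks). (U div b, (U mod b) # ks)) bs (U, []))"

(* The sampler as a deterministic program on the bit sequence r; None means that the
   rejection loop does not terminate on r. *)
definition batched_sampler :: "nat \<Rightarrow> nat \<Rightarrow> (nat \<Rightarrow> bool) \<Rightarrow> nat list option" where
  "batched_sampler b N r =
     (let Q = b ^ N; q = nat \<lceil>log 2 (real Q)\<rceil>
      in map_option (\<lambda>(U, p). inverse_horner (replicate N b) U)
           (while_option (\<lambda>(U, p). U \<ge> Q) (\<lambda>(U, p). draw_bits r p q) (draw_bits r 0 q)))"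

end

theory Submission
  imports Defs
begin

text \<open>
  The successive \<open>q\<close>-bit blocks are independent and uniform on \<open>{..<2 ^ q}\<close>. With acceptance set
  \<open>A\<close> inside a finite set \<open>B\<close> of equally likely outcomes, the probability that the loop stops in
  round \<open>k\<close> with the value \<open>a \<in> A\<close> is \<open>(1 - card A / card B) ^ k / card B\<close>. Summing over \<open>k\<close>
  gives \<open>1 / card A\<close>, and summing this over \<open>a\<close> gives almost sure termination. The inverse Horner
  decomposition is a bijection from \<open>{..<b ^ N}\<close> onto the digit lists, so the output is uniform on
  a product set, and its coordinates are independent.
\<close>

section \<open>Rejection sampling from independent uniform values\<close>

text \<open>The point masses on \<open>A\<close> already add up to 1, so \<open>X\<close> lies in
  \<open>A\<close> almost surely and nothing has to be checked outside \<open>A\<close>: any event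
  may be replaced by its intersection with \<open>A\<close>, where the law is a finite sum.\<close>

lemma (in prob_space) distr_eq_pmf_of_setI:
  assumes X: "X \<in> M \<rightarrow>\<^sub>M count_space UNIV" and A: "finite A" "A \<noteq> {}"
    and eq: "\<And>x. x \<in> A \<Longrightarrow> prob (X -` {x} \<inter> space M) = 1 / card A"
  shows "distr M (count_space UNIV) X = measure_pmf (pmf_of_set A)"
proof (rule measure_eqI)
  let ?D = "distr M (count_space UNIV) X"
  interpret D: prob_space ?D
    by (rule prob_space_distr[OF X])
  have fin: "D.prob C = card C / card A" if "C \<subseteq> A" for C
  proof -
    have "finite C"
      using that A(1) by (rule finite_subset)
    then have "D.prob C = (\<Sum>x\<in>C. D.prob {x})"
      by (intro D.finite_measure_eq_sum_singleton) auto
    also have "\<dots> = (\<Sum>x\<in>C. 1 / card A)"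
      using that by (intro sum.cong) (auto simp: measure_distr X eq)
    finally show ?thesis by simp
  qed
  show "sets ?D = sets (measure_pmf (pmf_of_set A))" by simp
  fix B assume "B \<in> sets ?D"
  have "D.prob A = 1"
    using fin[of A] A by simp
  then have "AE x in ?D. x \<in> A"
    by (subst D.AE_in_set_eq_1) auto
  then have "D.prob B = D.prob (A \<inter> B)"
    by (intro D.finite_measure_eq_AE) auto
  then show "emeasure ?D B = emeasure (measure_pmf (pmf_of_set A)) B"
    using A by (simp add: D.emeasure_eq_measure measure_pmf.emeasure_eq_measure
        measure_pmf_of_set fin)
qed

lemma (in prob_space) prob_first_accepted:
  assumes indep: "indep_vars (\<lambda>_. count_space UNIV) V UNIV"
    and distr: "\<And>k::nat. distr M (count_space UNIV) (V k) = measure_pmf (pmf_of_set B)"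
    and B: "finite B" and A: "A \<subseteq> B" "A \<noteq> {}" and a: "a \<in> A"
  shows "prob {\<omega> \<in> space M. \<exists>k. V k \<omega> = a \<and> (\<forall>j<k. V j \<omega> \<notin> A)} = 1 / card A"
proof -
  have V[measurable]: "V k \<in> M \<rightarrow>\<^sub>M count_space UNIV" for k
    using indep by (auto simp: indep_vars_def)
  have [measurable]: "Measurable.pred M (\<lambda>\<omega>. V k \<omega> = a)" "Measurable.pred M (\<lambda>\<omega>. V k \<omega> \<in> A)" for k
    by (rule measurable_compose[OF V], simp)+
  have finA: "finite A" and nz: "card A > 0" "card B > 0" "B \<noteq> {}"
    using A B finite_subset by (auto simp: card_gt_0_iff)
  have pV: "prob (V k -` C \<inter> space M) = card (B \<inter> C) / card B" for k C
  proof -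
    have "prob (V k -` C \<inter> space M) = measure (distr M (count_space UNIV) (V k)) C"
      by (simp add: measure_distr)
    then show ?thesis
      using nz B by (simp add: distr measure_pmf_of_set)
  qed
  \<comment> \<open>The probability that a single round rejects.\<close>
  define c :: real where "c = 1 - card A / card B"
  have le: "card A \<le> card B" using A B by (simp add: card_mono)
  have rej: "prob (V k -` (- A) \<inter> space M) = c" for k
  proof -
    have "B \<inter> - A = B - A" by auto
    then show ?thesis
      using le nz finA A by (simp add: pV c_def card_Diff_subset of_nat_diff field_simps)
  qed
  define E where "E k = {\<omega> \<in> space M. V k \<omega> = a \<and> (\<forall>j<k. V j \<omega> \<notin> A)}" for k
  have E: "prob (E k) = c ^ k / card B" for k
  proof -
    \<comment> \<open>One constraint per round turns \<open>E k\<close> into an intersection over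
      rounds 0 to \<open>k\<close>, which independence factorises.\<close>
    let ?C = "\<lambda>j. if j = k then {a} else - A"
    have "E k = (\<Inter>j\<in>{..k}. V j -` ?C j \<inter> space M)"
      by (auto simp: E_def split: if_splits)
    also have "prob \<dots> = (\<Prod>j\<in>{..k}. prob (V j -` ?C j \<inter> space M))"
      by (rule indep_varsD[OF indep]) auto
    also have "\<dots> = (\<Prod>j<k. prob (V j -` ?C j \<inter> space M)) * prob (V k -` {a} \<inter> space M)"
      by (simp add: lessThan_Suc_atMost[symmetric])
    also have "(\<Prod>j<k. prob (V j -` ?C j \<inter> space M)) = (\<Prod>j<k. c)"
      by (intro prod.cong) (auto simp: rej)
    also have "prob (V k -` {a} \<inter> space M) = 1 / card B"
    proof -
      have "B \<inter> {a} = {a}" using a A by auto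
      then show ?thesis by (simp add: pV)
    qed
    finally show ?thesis by simp
  qed
  have "(\<lambda>k. prob (E k)) sums prob (\<Union>k. E k)"
  proof (rule finite_measure_UNION)
    show "range E \<subseteq> events"
      unfolding E_def by (intro image_subsetI) measurable
    \<comment> \<open>If \<open>a\<close> were the stopping value in rounds \<open>j < k\<close>,
      round \<open>j\<close> would have hit \<open>A\<close>, which \<open>E k\<close>
      forbids.\<close>
    show "disjoint_family E"
      using a by (auto simp: disjoint_family_on_def E_def) (metis linorder_neqE_nat)
  qed
  \<comment> \<open>The geometric series converges because 0 < \<open>card A\<close> and
    \<open>card A\<close> is at most \<open>card B\<close>, so \<open>c\<close> lies in [0,
    1).\<close>
  moreover have "(\<lambda>k. prob (E k)) sums (1 / (1 - c) / card B)"
    unfolding E using le nz by (intro sums_divide geometric_sums) (auto simp: c_def)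
  ultimately have "prob (\<Union>k. E k) = 1 / (1 - c) / card B"
    by (rule sums_unique2)
  also have "\<dots> = 1 / card A"
    using nz by (simp add: c_def)
  also have "(\<Union>k. E k) = {\<omega> \<in> space M. \<exists>k. V k \<omega> = a \<and> (\<forall>j<k. V j \<omega> \<notin> A)}"
    by (auto simp: E_def)
  finally show ?thesis .
qed

text \<open>The stopping round takes countably many values. Where no round accepts,
  \<open>LEAST\<close> is still one fixed number, so measurability needs no exception there.\<close>

lemma (in prob_space) rejection_sampling_measurable:
  assumes [measurable]: "\<And>k::nat. V k \<in> M \<rightarrow>\<^sub>M count_space UNIV"
  shows "(\<lambda>\<omega>. V (LEAST k. V k \<omega> \<in> A) \<omega>) \<in> M \<rightarrow>\<^sub>M count_space UNIV"
proof -
  have [measurable]: "Measurable.pred M (\<lambda>\<omega>. V k \<omega> \<in> A)" for k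
    by (rule measurable_compose[OF assms]) simp
  show ?thesis
    by (rule measurable_compose_countable[where f=V]) measurable
qed

lemma (in prob_space)
  assumes indep: "indep_vars (\<lambda>_. count_space UNIV) V UNIV"
    and distr: "\<And>k::nat. distr M (count_space UNIV) (V k) = measure_pmf (pmf_of_set B)"
    and B: "finite B" and A: "A \<subseteq> B" "A \<noteq> {}"
  shows rejection_sampling_AE: "AE \<omega> in M. \<exists>k. V k \<omega> \<in> A"
    and rejection_sampling_distr:
      "distr M (count_space UNIV) (\<lambda>\<omega>. V (LEAST k. V k \<omega> \<in> A) \<omega>) = measure_pmf (pmf_of_set A)"
proof -
  have V[measurable]: "V k \<in> M \<rightarrow>\<^sub>M count_space UNIV" for k
    using indep by (auto simp: indep_vars_def)
  have [measurable]: "Measurable.pred M (\<lambda>\<omega>. V k \<omega> = a)" "Measurable.pred M (\<lambda>\<omega>. V k \<omega> \<in> A)" for k a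
    by (rule measurable_compose[OF V], simp)+
  have fin: "finite A" and "card A > 0"
    using A B finite_subset by (auto simp: card_gt_0_iff)
  define F where "F a = {\<omega> \<in> space M. \<exists>k. V k \<omega> = a \<and> (\<forall>j<k. V j \<omega> \<notin> A)}" for a
  have F: "prob (F a) = 1 / card A" if "a \<in> A" for a
    unfolding F_def by (rule prob_first_accepted[OF indep distr B A that])
  have F_events: "F a \<in> events" for a
    unfolding F_def by measurable
  have first: "V (LEAST k. V k \<omega> \<in> A) \<omega> = a" if "\<omega> \<in> F a" "a \<in> A" for a \<omega>
  proof -
    obtain k where k: "V k \<omega> = a" "\<forall>j<k. V j \<omega> \<notin> A"
      using \<open>\<omega> \<in> F a\<close> by (auto simp: F_def)
    then have "(LEAST k. V k \<omega> \<in> A) = k"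
      using \<open>a \<in> A\<close> by (intro Least_equality) (auto intro: leI)
    then show ?thesis using k by simp
  qed
  have least: "V (LEAST k. V k \<omega> \<in> A) \<omega> \<in> A" "\<omega> \<in> F (V (LEAST k. V k \<omega> \<in> A) \<omega>)"
    if \<omega>: "\<omega> \<in> space M" and ex: "\<exists>k. V k \<omega> \<in> A" for \<omega>
  proof -
    show "V (LEAST k. V k \<omega> \<in> A) \<omega> \<in> A"
      using ex by (rule LeastI_ex)
    have "\<forall>j<(LEAST k. V k \<omega> \<in> A). V j \<omega> \<notin> A"
      by (blast dest: not_less_Least)
    with \<omega> show "\<omega> \<in> F (V (LEAST k. V k \<omega> \<in> A) \<omega>)"
      unfolding F_def by blast
  qed
  have Un: "{\<omega> \<in> space M. \<exists>k. V k \<omega> \<in> A} = (\<Union>a\<in>A. F a)"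
  proof (intro subset_antisym subsetI)
    fix \<omega> assume "\<omega> \<in> {\<omega> \<in> space M. \<exists>k. V k \<omega> \<in> A}"
    then show "\<omega> \<in> (\<Union>a\<in>A. F a)"
      using least[of \<omega>] by blast
  next
    fix \<omega> assume "\<omega> \<in> (\<Union>a\<in>A. F a)"
    then show "\<omega> \<in> {\<omega> \<in> space M. \<exists>k. V k \<omega> \<in> A}"
      unfolding F_def by blast
  qed
  \<comment> \<open>By \<open>first\<close>, membership in \<open>F a\<close> determines
    \<open>a\<close>.\<close>
  have "disjoint_family_on F A"
    unfolding disjoint_family_on_def using first by blast
  then have "prob (\<Union>a\<in>A. F a) = (\<Sum>a\<in>A. prob (F a))"
    using fin F_events by (intro finite_measure_finite_Union) auto
  then have "prob {\<omega> \<in> space M. \<exists>k. V k \<omega> \<in> A} = 1"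
    using \<open>card A > 0\<close> by (simp add: Un F)
  then show AE: "AE \<omega> in M. \<exists>k. V k \<omega> \<in> A"
    by (subst (asm) prob_Collect_eq_1) auto
  have X: "(\<lambda>\<omega>. V (LEAST k. V k \<omega> \<in> A) \<omega>) \<in> M \<rightarrow>\<^sub>M count_space UNIV"
    using V by (rule rejection_sampling_measurable)
  show "distr M (count_space UNIV) (\<lambda>\<omega>. V (LEAST k. V k \<omega> \<in> A) \<omega>) = measure_pmf (pmf_of_set A)"
  proof (rule distr_eq_pmf_of_setI[OF X fin A(2)])
    fix a assume a: "a \<in> A"
    \<comment> \<open>The two events can differ where nothing is ever accepted: there
      \<open>LEAST\<close> is arbitrary and may yield \<open>a\<close>, while \<open>F a\<close>
      fails. This is a null set.\<close>
    have "prob ((\<lambda>\<omega>. V (LEAST k. V k \<omega> \<in> A) \<omega>) -` {a} \<inter> space M) = prob (F a)"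
    proof (rule finite_measure_eq_AE)
      show "AE \<omega> in M. \<omega> \<in> (\<lambda>\<omega>. V (LEAST k. V k \<omega> \<in> A) \<omega>) -` {a} \<inter> space M \<longleftrightarrow> \<omega> \<in> F a"
        using AE AE_space
      proof eventually_elim
        case (elim \<omega>)
        then show ?case
          using least[of \<omega>] first[of \<omega> a] a by blast
      qed
      show "(\<lambda>\<omega>. V (LEAST k. V k \<omega> \<in> A) \<omega>) -` {a} \<inter> space M \<in> events"
        using X by (rule measurable_sets) simp
    qed (rule F_events)
    then show "prob ((\<lambda>\<omega>. V (LEAST k. V k \<omega> \<in> A) \<omega>) -` {a} \<inter> space M) = 1 / card A"
      by (simp add: F a)
  qed
qed

section \<open>Bit blocks and the rejection loop\<close>

text \<open>Naturals agree iff all their bits do, and \<open>u\<close> has no bit at position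
  \<open>q\<close> or above. The first bit read is the most significant, hence the index
  \<open>q - 1 - i\<close>. This exhibits the event as a condition on \<open>q\<close> separate
  bits.\<close>

lemma draw_bits_eq_iff:
  fixes u :: nat
  assumes "u < 2 ^ q"
  shows "fst (draw_bits r p q) = u \<longleftrightarrow> (\<forall>i<q. r (p + i) = bit u (q - 1 - i))"
    (is "?h = u \<longleftrightarrow> ?R")
proof -
  have b: "bit ?h i \<longleftrightarrow> i < q \<and> r (p + (q - 1 - i))" for i
    by (auto simp: draw_bits_def bit_horner_sum_bit_iff rev_nth)
  have u: "bit u i \<Longrightarrow> i < q" for i
    using assms by (metis bit_take_bit_iff take_bit_nat_eq_self)
  have "?h = u \<longleftrightarrow> (\<forall>i<q. r (p + (q - 1 - i)) = bit u i)"
    unfolding bit_eq_iff b using u by (simp only: possible_bit_nat) blast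
  also have "\<dots> \<longleftrightarrow> ?R"
  \<comment> \<open>The reflection of \<open>i\<close> to \<open>q - 1 - i\<close> is an involution
    of \<open>{..<q}\<close>.\<close>
  proof -
    have q: "q - 1 - i < q" "q - 1 - (q - 1 - i) = i" if "i < q" for i
      using that by auto
    show ?thesis
    proof (rule iffI; intro allI impI)
      fix i assume *: "\<forall>i<q. r (p + (q - 1 - i)) = bit u i" and i: "i < q"
      show "r (p + i) = bit u (q - 1 - i)"
        using *[rule_format, OF q(1)[OF i]] unfolding q(2)[OF i] .
    next
      fix i assume *: "\<forall>i<q. r (p + i) = bit u (q - 1 - i)" and i: "i < q"
      show "r (p + (q - 1 - i)) = bit u i"
        using *[rule_format, OF q(1)[OF i]] unfolding q(2)[OF i] .
    qed
  qed
  finally show ?thesis .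
qed

lemma draw_bits_less: "fst (draw_bits r p q) < 2 ^ q"
  using horner_sum_of_bool_2_less[of "rev (map r [p..<p + q])"] by (simp add: draw_bits_def)

text \<open>The loop body ignores the rejected \<open>U\<close> and only advances the position by
  \<open>q\<close>, so iteration \<open>k\<close> reads block \<open>k\<close>.\<close>

lemma funpow_draw_bits:
  "((\<lambda>(U, p). draw_bits r p q) ^^ k) (draw_bits r 0 q) = draw_bits r (k * q) q"
  by (induction k) (simp_all add: draw_bits_def add.commute)

text \<open>Bridge from the program to the probabilistic model: \<open>while_option\<close> is
  defined through the least iterate violating the loop condition, that is, the first accepted
  block.\<close>

lemma batched_sampler_eq:
  fixes r :: "nat \<Rightarrow> bool" and b N :: nat
  defines "q \<equiv> nat \<lceil>log 2 (real (b ^ N))\<rceil>"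
  defines "V \<equiv> \<lambda>k. fst (draw_bits r (k * q) q)"
  shows "batched_sampler b N r =
    (if \<exists>k. V k < b ^ N then Some (inverse_horner (replicate N b) (V (LEAST k. V k < b ^ N))) else None)"
  unfolding batched_sampler_def Let_def q_def[symmetric] while_option_def V_def funpow_draw_bits
  by (simp add: case_prod_unfold not_le)

section \<open>Inverse Horner decomposition as a bijection\<close>

text \<open>The head of the list is processed last, after \<open>N\<close> divisions by
  \<open>b\<close>. Induction on \<open>N\<close> can therefore peel off the most significant digit
  while leaving \<open>U\<close> unchanged in the tail.\<close>

lemma inverse_horner_replicate_Suc:
  "inverse_horner (replicate (Suc N) b) U = (U div b ^ N mod b) # inverse_horner (replicate N b) U"
proof -
  have "fst (foldr (\<lambda>b (U, ks). (U div b, (U mod b) # ks)) (replicate N b) (U, [])) = U div b ^ N"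
    by (induction N) (simp_all add: case_prod_unfold, metis div_mult2_eq mult.commute)
  then show ?thesis
    by (simp add: inverse_horner_def case_prod_unfold)
qed

lemma length_inverse_horner_replicate: "length (inverse_horner (replicate N b) U) = N"
  by (induction N) (simp_all add: inverse_horner_replicate_Suc del: replicate_Suc, simp add: inverse_horner_def)

lemma set_inverse_horner_replicate: "b > 0 \<Longrightarrow> set (inverse_horner (replicate N b) U) \<subseteq> {..<b}"
  by (induction N) (simp_all add: inverse_horner_replicate_Suc del: replicate_Suc, simp add: inverse_horner_def)

text \<open>Supplies a left inverse on \<open>{..<b ^ N}\<close>. The induction step splits
  \<open>U mod (b ^ N * b)\<close> into its top digit times \<open>b ^ N\<close> plus
  \<open>U mod b ^ N\<close>.\<close>

lemma horner_sum_inverse_horner: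
  "horner_sum id b (rev (inverse_horner (replicate N b) U)) = U mod b ^ N"
proof (induction N)
  case 0
  then show ?case by (simp add: inverse_horner_def)
next
  case (Suc N)
  then show ?case
    by (simp add: inverse_horner_replicate_Suc length_inverse_horner_replicate horner_sum_append
        mod_mult2_eq mult.commute[of b] del: replicate_Suc)
qed

text \<open>Injectivity comes from the left inverse; surjectivity from counting, as both sides have
  \<open>b ^ N\<close> elements.\<close>

lemma bij_betw_inverse_horner:
  assumes "b > 0"
  shows "bij_betw (inverse_horner (replicate N b)) {..<b ^ N} {ks. length ks = N \<and> set ks \<subseteq> {..<b}}"
proof -
  let ?L = "{ks. length ks = N \<and> set ks \<subseteq> {..<b}}"
  have L: "finite ?L" "card ?L = b ^ N"
    using finite_lists_length_eq[of "{..<b}" N] card_lists_length_eq[of "{..<b}" N]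
    by (simp_all add: conj_commute)
  have inj: "inj_on (inverse_horner (replicate N b)) {..<b ^ N}"
    by (rule inj_onI) (metis horner_sum_inverse_horner lessThan_iff mod_less)
  have "inverse_horner (replicate N b) ` {..<b ^ N} = ?L"
    using L assms by (intro card_subset_eq)
      (auto simp: card_image[OF inj] length_inverse_horner_replicate dest!: set_inverse_horner_replicate[THEN subsetD, rotated])
  with inj show ?thesis by (simp add: bij_betw_def)
qed

section \<open>Independence of coordinates under a uniform law\<close>

text \<open>Independence says that the joint law is the product of the marginals, and both sides are
  unchanged when the family is pulled back along \<open>f\<close>.\<close>

lemma (in prob_space) indep_vars_distrD:
  assumes f: "f \<in> M \<rightarrow>\<^sub>M N" and I: "I \<noteq> {}"
    and X: "\<And>i. i \<in> I \<Longrightarrow> X i \<in> N \<rightarrow>\<^sub>M M' i"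
    and indep: "prob_space.indep_vars (distr M N f) M' X I"
  shows "indep_vars M' (\<lambda>i x. X i (f x)) I"
proof -
  interpret D: prob_space "distr M N f"
    by (rule prob_space_distr[OF f])
  have "distr (distr M N f) (PiM I M') (\<lambda>x. \<lambda>i\<in>I. X i x) = (\<Pi>\<^sub>M i\<in>I. distr (distr M N f) (M' i) (X i))"
    using indep X by (subst D.indep_vars_iff_distr_eq_PiM'[symmetric]) (auto simp: I)
  also have "distr (distr M N f) (PiM I M') (\<lambda>x. \<lambda>i\<in>I. X i x) = distr M (PiM I M') (\<lambda>x. \<lambda>i\<in>I. X i (f x))"
    using X f by (subst distr_distr) (auto simp: comp_def intro!: measurable_restrict)
  also have "(\<Pi>\<^sub>M i\<in>I. distr (distr M N f) (M' i) (X i)) = (\<Pi>\<^sub>M i\<in>I. distr M (M' i) (\<lambda>x. X i (f x)))"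
    using X f by (intro PiM_cong) (auto simp: distr_distr comp_def)
  finally show ?thesis
    using X f I by (subst indep_vars_iff_distr_eq_PiM') (auto intro: measurable_compose)
qed

text \<open>Lists of length \<open>n\<close> are encoded as functions with default \<open>d\<close>
  outside \<open>{..<n}\<close>. The uniform law on these functions is \<open>Pi_pmf\<close> of
  uniform laws, whose coordinates are independent.\<close>

lemma indep_vars_nth_pmf_of_set:
  assumes A: "finite A" "A \<noteq> {}" and n: "n > 0"
  shows "prob_space.indep_vars (measure_pmf (pmf_of_set {xs. length xs = n \<and> set xs \<subseteq> A}))
    (\<lambda>_. count_space UNIV) (\<lambda>i xs. xs ! i) {..<n}"
proof -
  obtain d where d: "d \<in> A" using A by auto
  define p where "p = pmf_of_set {xs. length xs = n \<and> set xs \<subseteq> A}"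
  let ?L = "{xs. length xs = n \<and> set xs \<subseteq> A}" and ?g = "\<lambda>xs i. if i < n then xs ! i else d"
  have L: "finite ?L" "?L \<noteq> {}"
    using finite_lists_length_eq[OF A(1), of n] d
    by (auto simp: conj_commute intro!: exI[of _ "replicate n d"])
  have bij: "bij_betw ?g ?L (PiE_dflt {..<n} d (\<lambda>_. A))"
  proof (rule bij_betw_byWitness[where f' = "\<lambda>f. map f [0..<n]"])
    show "?g ` ?L \<subseteq> PiE_dflt {..<n} d (\<lambda>_. A)"
      by (auto simp: PiE_dflt_def)
  qed (auto simp: PiE_dflt_def list_eq_iff_nth_eq)
  have "map_pmf ?g p = Pi_pmf {..<n} d (\<lambda>_. pmf_of_set A)"
    unfolding p_def using A L by (simp add: map_pmf_of_set_bij_betw[OF bij] Pi_pmf_of_set)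
  then have "distr p (count_space UNIV) ?g = Pi_pmf {..<n} d (\<lambda>_. pmf_of_set A)"
    by (simp add: map_pmf_rep_eq[symmetric])
  then have "prob_space.indep_vars (distr p (count_space UNIV) ?g) (\<lambda>_. count_space UNIV) (\<lambda>i f. f i) {..<n}"
    using indep_vars_Pi_pmf[of "{..<n}" d "\<lambda>_. pmf_of_set A"] by simp
  then have "prob_space.indep_vars p (\<lambda>_. count_space UNIV) (\<lambda>i xs. ?g xs i) {..<n}"
    using n by (intro prob_space.indep_vars_distrD[where N = "count_space UNIV" and f = ?g
          and X = "\<lambda>i f. f i", OF measure_pmf.prob_space_axioms]) auto
  then show ?thesis
    unfolding p_def
    by (subst (asm) prob_space.indep_vars_cong[OF measure_pmf.prob_space_axioms, where Y="\<lambda>i xs. xs ! i" and J="{..<n}" and N'="\<lambda>_. count_space UNIV"]) auto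
qed

section \<open>Blocks of random bits are independent and uniform\<close>

lemma
  assumes "random_bit_source M R"
  shows random_bit_source_draw_bits_indep:
      "prob_space.indep_vars M (\<lambda>_. count_space UNIV) (\<lambda>k \<omega>. fst (draw_bits (\<lambda>n. R n \<omega>) (k * q) q)) UNIV"
    and random_bit_source_draw_bits_distr:
      "distr M (count_space UNIV) (\<lambda>\<omega>. fst (draw_bits (\<lambda>n. R n \<omega>) p q)) = measure_pmf (pmf_of_set {..<2 ^ q})"
proof -
  interpret prob_space M
    using assms by (simp add: random_bit_source_def)
  have indep: "indep_vars (\<lambda>_. count_space UNIV) R UNIV"
    and unif: "distr M (count_space UNIV) (R n) = measure_pmf (pmf_of_set UNIV)" for n
    using assms by (auto simp: random_bit_source_def)
  have R[measurable]: "R n \<in> M \<rightarrow>\<^sub>M count_space UNIV" for n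
    using indep by (auto simp: indep_vars_def)
  have pR: "prob (R n -` {x} \<inter> space M) = 1 / 2" for n x
  proof -
    have "prob (R n -` {x} \<inter> space M) = measure (distr M (count_space UNIV) (R n)) {x}"
      by (simp add: measure_distr)
    then show ?thesis by (simp add: unif measure_pmf_of_set)
  qed
  \<comment> \<open>Stated for any index set \<open>K\<close> covering the block: \<open>K\<close>
    is the block itself for independence and \<open>UNIV\<close> for measurability on
    \<open>M\<close>.\<close>
  have meas: "(\<lambda>f. fst (draw_bits f p q)) \<in> PiM K (\<lambda>_. count_space UNIV) \<rightarrow>\<^sub>M count_space UNIV"
    if K: "{p..<p + q} \<subseteq> K" for p K
  proof -
    have [measurable]: "(\<lambda>f. f (p + i)) \<in> PiM K (\<lambda>_. count_space UNIV) \<rightarrow>\<^sub>M count_space (UNIV :: bool set)"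
      if "i < q" for i
      using K that by (intro measurable_component_singleton) auto
    have "(\<lambda>f. fst (draw_bits f p q)) -` {u} \<inter> space (PiM K (\<lambda>_. count_space UNIV)) \<in> sets (PiM K (\<lambda>_. count_space UNIV))"
      for u
    proof (cases "u < 2 ^ q")
      case True
      have "(\<lambda>f. fst (draw_bits f p q)) -` {u} \<inter> space (PiM K (\<lambda>_. count_space UNIV)) =
          {f \<in> space (PiM K (\<lambda>_. count_space UNIV)). \<forall>i\<in>{..<q}. f (p + i) = bit u (q - 1 - i)}"
        using True by (simp add: draw_bits_eq_iff vimage_def Collect_conj_eq Int_commute Ball_def)
      also have "\<dots> \<in> sets (PiM K (\<lambda>_. count_space UNIV))"
        by measurable
      finally show ?thesis .
    next
      case False
      then have "(\<lambda>f. fst (draw_bits f p q)) -` {u} = {}"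
        using draw_bits_less[of _ p q] by auto
      then show ?thesis by simp
    qed
    then show ?thesis
      by (subst measurable_count_space_eq2_countable) auto
  qed
  have "indep_vars (\<lambda>k. PiM {k * q..<k * q + q} (\<lambda>_. count_space UNIV))
      (\<lambda>k \<omega>. restrict (\<lambda>n. R n \<omega>) {k * q..<k * q + q}) UNIV"
  proof (rule indep_vars_restrict[OF indep])
    show "disjoint_family_on (\<lambda>k. {k * q..<k * q + q}) UNIV"
    proof (cases "q = 0")
      case False
      \<comment> \<open>The block index is recovered from a position by division, so distinct blocks
        share no bit.\<close>
      have "k = n div q" if "n \<in> {k * q..<k * q + q}" for k n
        using that by (auto intro!: div_nat_eqI[symmetric] simp: algebra_simps)
      then show ?thesis
        unfolding disjoint_family_on_def by blast
    qed (auto simp: disjoint_family_on_def)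
  qed auto
  then have "indep_vars (\<lambda>_. count_space UNIV)
      (\<lambda>k \<omega>. fst (draw_bits (restrict (\<lambda>n. R n \<omega>) {k * q..<k * q + q}) (k * q) q)) UNIV"
    by (rule indep_vars_compose2) (rule meas, simp)
  \<comment> \<open>Restriction alters only positions that this draw never reads.\<close>
  moreover have "draw_bits (restrict f {p..<p + q}) p q = draw_bits f p q" for f p
  proof -
    have "map (restrict f {p..<p + q}) [p..<p + q] = map f [p..<p + q]"
      by (rule map_cong) simp_all
    then show ?thesis by (simp only: draw_bits_def)
  qed
  ultimately show "indep_vars (\<lambda>_. count_space UNIV) (\<lambda>k \<omega>. fst (draw_bits (\<lambda>n. R n \<omega>) (k * q) q)) UNIV"
    by (simp only:)
  have V: "(\<lambda>\<omega>. fst (draw_bits (\<lambda>n. R n \<omega>) p q)) \<in> M \<rightarrow>\<^sub>M count_space UNIV"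
    by (rule measurable_compose[OF _ meas[of p UNIV], where f="\<lambda>\<omega> n. R n \<omega>"])
      (auto intro!: measurable_PiM_single')
  show "distr M (count_space UNIV) (\<lambda>\<omega>. fst (draw_bits (\<lambda>n. R n \<omega>) p q)) = measure_pmf (pmf_of_set {..<2 ^ q})"
  proof (rule distr_eq_pmf_of_setI[OF V])
    fix u :: nat assume u: "u \<in> {..<2 ^ q}"
    show "prob ((\<lambda>\<omega>. fst (draw_bits (\<lambda>n. R n \<omega>) p q)) -` {u} \<inter> space M) = 1 / card {..<2 ^ q :: nat}"
    \<comment> \<open>For \<open>q = 0\<close> the intersection below would range over no index and
      give \<open>UNIV\<close> instead of \<open>space M\<close>; here the only value is 0 and the
      event is all of \<open>space M\<close>.\<close>
    proof (cases "q = 0")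
      case True
      then show ?thesis using u by (simp add: draw_bits_def prob_space)
    next
      case False
      have "(\<lambda>\<omega>. fst (draw_bits (\<lambda>n. R n \<omega>) p q)) -` {u} \<inter> space M =
          (\<Inter>n\<in>{p..<p + q}. R n -` {bit u (q - 1 - (n - p))} \<inter> space M)" (is "?l = ?r")
      proof -
        \<comment> \<open>Passes from offsets \<open>i\<close> within the block to absolute
          positions \<open>n = p + i\<close>.\<close>
        have "(\<forall>i<q. P (p + i) i) \<longleftrightarrow> (\<forall>n\<in>{p..<p + q}. P n (n - p))" for P
        proof (intro iffI ballI allI impI)
          fix n assume "\<forall>i<q. P (p + i) i" "n \<in> {p..<p + q}"
          then show "P n (n - p)" by (auto dest!: spec[of _ "n - p"])
        next
          fix i assume "\<forall>n\<in>{p..<p + q}. P n (n - p)" "i < q"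
          then show "P (p + i) i" by (auto dest!: bspec[of _ _ "p + i"])
        qed
        note iff = this[of "\<lambda>n i. R n \<omega> = bit u (q - 1 - i)" for \<omega>]
        have "\<omega> \<in> ?l \<longleftrightarrow> \<omega> \<in> ?r" for \<omega>
        proof -
          have "{p..<p + q} \<noteq> {}" using False by simp
          then have "\<omega> \<in> ?r \<longleftrightarrow> \<omega> \<in> space M \<and> (\<forall>n\<in>{p..<p + q}. R n \<omega> = bit u (q - 1 - (n - p)))"
            by blast
          moreover have "\<omega> \<in> ?l \<longleftrightarrow> \<omega> \<in> space M \<and> fst (draw_bits (\<lambda>n. R n \<omega>) p q) = u"
            by blast
          ultimately show ?thesis
            using u by (simp only: draw_bits_eq_iff lessThan_iff iff)
        qed
        then show ?thesis by blast
      qed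
      also have "prob \<dots> = (\<Prod>n\<in>{p..<p + q}. prob (R n -` {bit u (q - 1 - (n - p))} \<inter> space M))"
        using False by (intro indep_varsD[OF indep]) auto
      finally show ?thesis by (simp add: pR power_divide)
    qed
  qed (auto simp: lessThan_empty_iff)
qed

section \<open>Correctness of the sampler\<close>

theorem theorem9p2:
  fixes M :: "'a measure" and R :: "nat \<Rightarrow> 'a \<Rightarrow> bool" and b N :: nat
  assumes "b \<ge> 2" and "N \<ge> 1"
    and "random_bit_source M R"
  defines "S \<equiv> \<lambda>\<omega>. batched_sampler b N (\<lambda>n. R n \<omega>)"
  shows "(AE \<omega> in M. S \<omega> \<noteq> None)
    \<and> S \<in> M \<rightarrow>\<^sub>M count_space UNIV
    \<and> distr M (count_space UNIV) (\<lambda>\<omega>. the (S \<omega>)) =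
        measure_pmf (pmf_of_set {ks. length ks = N \<and> set ks \<subseteq> {0..b - 1}})
    \<and> prob_space.indep_vars M (\<lambda>_. count_space UNIV) (\<lambda>i \<omega>. the (S \<omega>) ! i) {..<N}"
proof -
  interpret prob_space M
    using assms(3) by (simp add: random_bit_source_def)
  define q where "q = nat \<lceil>log 2 (real (b ^ N))\<rceil>"
  define V where "V k \<omega> = fst (draw_bits (\<lambda>n. R n \<omega>) (k * q) q)" for k \<omega>
  let ?A = "{..<b ^ N}" and ?L = "{ks. length ks = N \<and> set ks \<subseteq> {0..b - 1}}"
  let ?D = "inverse_horner (replicate N b)"
  have S: "S \<omega> = (if \<exists>k. V k \<omega> \<in> ?A then Some (?D (V (LEAST k. V k \<omega> \<in> ?A) \<omega>)) else None)" for \<omega>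
    by (simp add: S_def batched_sampler_eq V_def q_def)
  \<comment> \<open>Rounding the logarithm up makes \<open>2 ^ q\<close> at least
    \<open>b ^ N\<close>, so every acceptable value can be drawn.\<close>
  have "log 2 (real (b ^ N)) \<le> real q"
    unfolding q_def by linarith
  then have "real (b ^ N) \<le> 2 powr real q"
    using assms(1) by (subst (asm) log_le_iff) auto
  then have "real (b ^ N) \<le> real (2 ^ q)"
    by (simp add: powr_realpow)
  then have A: "?A \<subseteq> {..<2 ^ q}" "?A \<noteq> {}"
    using assms(1) by (auto simp: lessThan_empty_iff simp del: of_nat_power)
  have indep: "indep_vars (\<lambda>_. count_space UNIV) V UNIV"
    unfolding V_def by (rule random_bit_source_draw_bits_indep[OF assms(3)])
  have unif: "distr M (count_space UNIV) (V k) = measure_pmf (pmf_of_set {..<2 ^ q})" for k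
    unfolding V_def by (rule random_bit_source_draw_bits_distr[OF assms(3)])
  have V[measurable]: "V k \<in> M \<rightarrow>\<^sub>M count_space UNIV" for k
    using indep by (auto simp: indep_vars_def)
  have X[measurable]: "(\<lambda>\<omega>. V (LEAST k. V k \<omega> \<in> ?A) \<omega>) \<in> M \<rightarrow>\<^sub>M count_space UNIV"
    using V by (rule rejection_sampling_measurable)
  have AE: "AE \<omega> in M. \<exists>k. V k \<omega> \<in> ?A"
    by (rule rejection_sampling_AE[OF indep unif _ A]) simp
  have terminates: "AE \<omega> in M. S \<omega> \<noteq> None"
    using AE by eventually_elim (simp add: S)
  have meas: "S \<in> M \<rightarrow>\<^sub>M count_space UNIV"
  proof -
    have "{\<omega> \<in> space M. \<exists>k. V k \<omega> \<in> ?A} \<in> events"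
    proof -
      have "{\<omega> \<in> space M. \<exists>k. V k \<omega> \<in> ?A} = (\<Union>k. V k -` ?A \<inter> space M)" by auto
      also have "\<dots> \<in> events" by (intro sets.countable_UN' measurable_sets[OF V]) auto
      finally show ?thesis .
    qed
    then show ?thesis
      unfolding S by (intro measurable_If measurable_compose[OF X]) auto
  qed
  then have meas': "(\<lambda>\<omega>. the (S \<omega>)) \<in> M \<rightarrow>\<^sub>M count_space UNIV"
    by (rule measurable_compose) simp
  have "?L = {ks. length ks = N \<and> set ks \<subseteq> {..<b}}"
    using assms(1) by (auto simp: subset_iff)
  then have bij: "bij_betw ?D ?A ?L"
    using bij_betw_inverse_horner[of b N] assms(1) by simp
  \<comment> \<open>\<open>the (S \<omega>)\<close> is unspecified where the loop diverges, so the
    equality with the decoded block is only almost sure.\<close>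
  have "distr M (count_space UNIV) (\<lambda>\<omega>. the (S \<omega>)) =
      distr M (count_space UNIV) (\<lambda>\<omega>. ?D (V (LEAST k. V k \<omega> \<in> ?A) \<omega>))"
  proof (rule distr_cong_AE)
    show "AE \<omega> in M. the (S \<omega>) = ?D (V (LEAST k. V k \<omega> \<in> ?A) \<omega>)"
      using AE by eventually_elim (simp add: S)
  qed (use meas' in simp_all)
  also have "\<dots> = distr (distr M (count_space UNIV) (\<lambda>\<omega>. V (LEAST k. V k \<omega> \<in> ?A) \<omega>)) (count_space UNIV) ?D"
    by (simp add: distr_distr comp_def)
  also have "\<dots> = map_pmf ?D (pmf_of_set ?A)"
    by (subst rejection_sampling_distr[OF indep unif _ A]) (simp_all add: map_pmf_rep_eq)
  also have "\<dots> = pmf_of_set ?L"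
    using map_pmf_of_set_bij_betw[OF bij A(2)] by simp
  finally have distr: "distr M (count_space UNIV) (\<lambda>\<omega>. the (S \<omega>)) = pmf_of_set ?L" .
  \<comment> \<open>Independence of the digits is read off the law of the whole output list.\<close>
  have "indep_vars (\<lambda>_. count_space UNIV) (\<lambda>i \<omega>. the (S \<omega>) ! i) {..<N}"
  proof (rule indep_vars_distrD[OF meas'])
    show "prob_space.indep_vars (distr M (count_space UNIV) (\<lambda>\<omega>. the (S \<omega>)))
        (\<lambda>_. count_space UNIV) (\<lambda>i ks. ks ! i) {..<N}"
      unfolding distr using assms(2) by (intro indep_vars_nth_pmf_of_set) auto
  qed (use assms(2) in \<open>auto simp: lessThan_empty_iff\<close>)
  with terminates meas distr show ?thesis by blast
qed

end
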